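(* Let $A$ be a finite alphabet and let $x \in A^{\mathbb{Z}}$. If $x$ is not uniformly recurrent and it is not true that $x$ is eventually periodic in both directions, then $$\limsup_{n\to\infty}\,(c_n(x) - 1.5n) = \infty.$$
   Context: A word over a finite set $A$ is an element of $A^n$, $n \in \mathbb{N} = \{1,2,\dots\}$; $n$ is its length. A word $w$ is a subword of a sequence $x \in A^{\mathbb{Z}}$ if there is $i$ with $x(i+j) = w(j)$ for all $1 \le j \le |w|$ (and similarly for subwords of words). The word complexity function $c_n(x)$ is the number of distinct words of length $n$ that are subwords of $x$. The sequence $x$ is uniformly recurrent if for every subword $w$ of $x$ there exists $N$ such that every $N$-letter subword of $x$ contains $w$ as a subword. A one-sided sequence $u \in A^{\mathbb{N}}$ is eventually periodic if there exist $n, N \in \mathbb{N}$ such that $u(k) = u(k+n)$ for all $k > N$; analogously for left-infinite sequences. A bi-infinite $x$ is eventually periodic in both directions if $x(0)x(1)x(2)\ldots$ and $\ldots x(-2)x(-1)$ are each eventually periodic. *)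

theory Defs
  imports "HOL-Library.Extended_Real" "HOL-Library.Sublist"
begin

text \<open>
  Words are lists (nonempty where it matters) and bi-infinite sequences are functions on the
  integers. Lists are indexed from 0, so the starting position \<open>i\<close> below is the mathematical
  one shifted by 1. The notion ``subword of a word'' is the contiguous \<^const>\<open>sublist\<close>.
\<close>

definition subword_of :: "'a list \<Rightarrow> (int \<Rightarrow> 'a) \<Rightarrow> bool" where
  "subword_of w x \<longleftrightarrow> (\<exists>i. \<forall>j<length w. x (i + int j) = w ! j)"

definition word_complexity :: "nat \<Rightarrow> (int \<Rightarrow> 'a) \<Rightarrow> nat" where
  "word_complexity n x = card {w. length w = n \<and> subword_of w x}"

definition uniformly_recurrent :: "(int \<Rightarrow> 'a) \<Rightarrow> bool" where
  "uniformly_recurrent x \<longleftrightarrow>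
     (\<forall>w. w \<noteq> [] \<and> subword_of w x \<longrightarrow>
        (\<exists>N\<ge>1. \<forall>v. length v = N \<and> subword_of v x \<longrightarrow> sublist w v))"

text \<open>
  One-sided sequences are indexed from 0 here; the threshold \<open>N\<close> is arbitrary, so this does not
  affect the notion. A left-infinite sequence is eventually periodic when its reversal is.
\<close>

definition eventually_periodic :: "(nat \<Rightarrow> 'a) \<Rightarrow> bool" where
  "eventually_periodic u \<longleftrightarrow> (\<exists>n\<ge>1. \<exists>N\<ge>1. \<forall>k>N. u k = u (k + n))"

definition eventually_periodic_both_directions :: "(int \<Rightarrow> 'a) \<Rightarrow> bool" where
  "eventually_periodic_both_directions x \<longleftrightarrow>
     eventually_periodic (\<lambda>k. x (int k)) \<and> eventually_periodic (\<lambda>k. x (- int k))"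

end

theory Submission
  imports Defs
begin

text \<open>
  Write \<open>c n\<close> for the complexity. A word is right special if it occurs with two different next
  letters; each right special word of length \<open>n\<close> contributes at least one to \<open>c (n + 1) - c n\<close>.
  Since \<open>x\<close> is not eventually periodic in both directions, this difference is always positive
  (\<open>complexity_strictly_grows\<close>). If it is at least 2 from some point on, then \<open>c n - 2 n\<close> is bounded
  below and the theorem is clear. So suppose that \<open>c (n + 1) = c n + 1\<close> for infinitely many \<open>n\<close>.

  Such an \<open>n\<close> has a single right special word \<open>r\<close>, with two next letters \<open>a\<close> and \<open>b\<close>
  (\<open>growth_one_unique_branching\<close>). Reading \<open>x\<close> is deterministic except at \<open>r\<close>, and \<open>r\<close> recurs without end
  in both directions, so \<open>x\<close> is a concatenation of two loops based at \<open>r\<close>, of lengths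
  \<open>p\<close> and \<open>q\<close>. Let \<open>w\<close> be a word that witnesses the failure of uniform recurrence. For \<open>n\<close> at least the
  length of \<open>w\<close>, exactly one of the loops avoids \<open>w\<close>: if neither met \<open>w\<close>, then \<open>w\<close> would not occur; if
  both did, then \<open>w\<close> would occur with bounded gaps. Let the loop at \<open>a\<close> be the one that avoids \<open>w\<close>, and
  call the loop at \<open>b\<close> an excursion. Arbitrarily long \<open>w\<close>-free stretches are arbitrarily long runs of
  the first loop, and so \<open>r\<close> itself is \<open>w\<close>-free.

  Let \<open>g\<close> (\<open>min_run\<close>) be the smallest number of \<open>a\<close>-loops between two consecutive excursions. The word spelled by \<open>r\<close>,
  then \<open>g\<close> loops, an excursion and \<open>g\<close> more loops has length \<open>n + 2 g p + q\<close>. It surrounds every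
  excursion, and it is right special: another excursion may follow, and a longer run may follow
  too, since otherwise \<open>x\<close> would be eventually periodic in both directions (\<open>longer_run\<close>). Its suffixes that contain \<open>w\<close>
  are right special, and they differ from the \<open>w\<close>-free right special words that exist in
  every length, namely the suffixes of the words \<open>r\<close> that belong to larger \<open>n\<close>. Counting one unit of
  growth at each length from \<open>n\<close> on and a second unit where both kinds exist, and using \<open>c n \<ge> q\<close>, gives for \<open>M = n + 2 g p + q + 1\<close>
  the bound \<open>c M \<ge> 3 g p + 2 q + n - |w|\<close>, that is, \<open>c M - 1.5 M \<ge> 0.5 (q - n) - |w|\<close> (\<open>complexity_large\<close>).

  Finally \<open>q - n\<close> tends to infinity (\<open>excursion_long\<close>). All occurrences of \<open>w\<close> inside
  one excursion lie within a distance of about \<open>q - n\<close> of each other, and those of different excursions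
  are at least about \<open>n\<close> apart; but \<open>x\<close> has occurrences of \<open>w\<close> at arbitrarily
  large distances, and any two of them share an excursion once \<open>n\<close> is
  large, which makes \<open>q - n\<close> at least about their distance.
\<close>

section \<open>Windows\<close>

definition window :: "(int \<Rightarrow> 'a) \<Rightarrow> nat \<Rightarrow> int \<Rightarrow> 'a list" where
  "window x n i = map (\<lambda>j. x (i + int j)) [0..<n]"

lemma length_window [simp]: "length (window x n i) = n"
  by (simp add: window_def)

lemma window_eq_iff:
  "window x n i = window x n j \<longleftrightarrow> (\<forall>k. 0 \<le> k \<and> k < int n \<longrightarrow> x (i + k) = x (j + k))"
proof
  assume eq: "window x n i = window x n j"
  show "\<forall>k. 0 \<le> k \<and> k < int n \<longrightarrow> x (i + k) = x (j + k)"
  proof (intro allI impI)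
    fix k assume k: "0 \<le> k \<and> k < int n"
    then have "window x n i ! nat k = window x n j ! nat k" "nat k < n" using eq by auto
    then show "x (i + k) = x (j + k)" using k by (simp add: window_def)
  qed
qed (auto simp: window_def)

lemma window_Suc: "window x (Suc n) i = window x n i @ [x (i + int n)]"
  by (simp add: window_def)

lemma window_step:
  assumes "window x n i = window x n j" "x (i + int n) = x (j + int n)"
  shows "window x n (i + 1) = window x n (j + 1)"
proof -
  have "window x (Suc n) i = window x (Suc n) j" using assms by (simp add: window_Suc)
  then have *: "x (i + k) = x (j + k)" if "0 \<le> k" "k < int n + 1" for k
    using that by (simp add: window_eq_iff)
  show ?thesis unfolding window_eq_iff
  proof (intro allI impI)
    fix k assume "0 \<le> k \<and> k < int n"
    then show "x (i + 1 + k) = x (j + 1 + k)" using *[of "1 + k"] by (simp add: add.assoc)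
  qed
qed

lemma window_sub:
  assumes "window x n i = window x n j" "0 \<le> s" "s + int m \<le> int n"
  shows "window x m (i + s) = window x m (j + s)"
proof -
  have *: "x (i + k) = x (j + k)" if "0 \<le> k" "k < int n" for k
    using assms that by (simp add: window_eq_iff)
  show ?thesis unfolding window_eq_iff
  proof (intro allI impI)
    fix k assume "0 \<le> k \<and> k < int m"
    then show "x (i + s + k) = x (j + s + k)"
      using assms(2,3) *[of "s + k"] by (simp add: add.assoc)
  qed
qed

lemma subword_of_iff_window: "subword_of w x \<longleftrightarrow> (\<exists>i. window x (length w) i = w)"
proof -
  have "window x (length w) i = w \<longleftrightarrow> (\<forall>j<length w. x (i + int j) = w ! j)" for i
    unfolding list_eq_iff_nth_eq by (simp add: window_def)
  then show ?thesis by (simp add: subword_of_def)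
qed

lemma word_complexity_eq_card_windows: "word_complexity n x = card (range (window x n))"
proof -
  have "(length v = n \<and> subword_of v x) \<longleftrightarrow> v \<in> range (window x n)" for v
    by (metis length_window rangeE rangeI subword_of_iff_window)
  then have "{w. length w = n \<and> subword_of w x} = range (window x n)" by blast
  then show ?thesis by (simp add: word_complexity_def)
qed

lemma finite_windows:
  assumes "finite (range x)" shows "finite (range (window x n))"
proof (rule finite_subset)
  show "range (window x n) \<subseteq> {w. set w \<subseteq> range x \<and> length w = n}"
    by (auto simp: window_def)
qed (use assms in \<open>simp add: finite_lists_length_eq\<close>)

section \<open>Branching and the growth of complexity\<close>

lemma card_image_add_card_le:
  assumes "finite X" "Z \<subseteq> X" "f ` X \<subseteq> f ` (X - Z)"
  shows "card (f ` X) + card Z \<le> card X"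
proof -
  have "card (f ` X) \<le> card (X - Z)"
    by (meson assms card_image_le card_mono finite_Diff finite_imageI le_trans)
  moreover have "card (X - Z) = card X - card Z" "card Z \<le> card X"
    using assms by (auto intro: card_Diff_subset card_mono finite_subset)
  ultimately show ?thesis by simp
qed

lemma butlast_windows: "butlast ` range (window x (Suc n)) = range (window x n)"
  by (force simp: window_Suc image_iff)

text \<open>
  Deleting last letters maps the words of length \<open>m + 1\<close> onto those of length \<open>m\<close>, and a right
  special word has two preimages.
\<close>

lemma complexity_growth_one:
  assumes fin: "finite (range x)"
    and eq: "window x m i = window x m j" and neq: "x (i + int m) \<noteq> x (j + int m)"
  shows "word_complexity m x + 1 \<le> word_complexity (Suc m) x"
proof -
  let ?X = "range (window x (Suc m))" and ?z = "window x (Suc m) i"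
  have "butlast ` ?X \<subseteq> butlast ` (?X - {?z})"
  proof
    fix v assume "v \<in> butlast ` ?X"
    then obtain k where v: "v = butlast (window x (Suc m) k)" by auto
    show "v \<in> butlast ` (?X - {?z})"
    proof (cases "window x (Suc m) k = ?z")
      case True
      then have "v = butlast (window x (Suc m) j)" using v eq by (simp add: window_Suc)
      moreover have "window x (Suc m) j \<noteq> ?z" using neq by (simp add: window_Suc)
      ultimately show ?thesis by blast
    next
      case False then show ?thesis using v by blast
    qed
  qed
  from card_image_add_card_le[OF finite_windows[OF fin] _ this]
  show ?thesis by (simp add: butlast_windows word_complexity_eq_card_windows)
qed

lemma complexity_growth_two:
  assumes fin: "finite (range x)"
    and eq: "window x m i = window x m j" and neq: "x (i + int m) \<noteq> x (j + int m)"
    and eq': "window x m i' = window x m j'" and neq': "x (i' + int m) \<noteq> x (j' + int m)"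
    and diff: "window x m i \<noteq> window x m i'"
  shows "word_complexity m x + 2 \<le> word_complexity (Suc m) x"
proof -
  let ?X = "range (window x (Suc m))"
  let ?z = "window x (Suc m) i" and ?z' = "window x (Suc m) i'"
  let ?Z = "{?z, ?z'}"
  have "butlast ` ?X \<subseteq> butlast ` (?X - ?Z)"
  proof
    fix v assume "v \<in> butlast ` ?X"
    then obtain k where v: "v = butlast (window x (Suc m) k)" by auto
    consider "window x (Suc m) k = ?z" | "window x (Suc m) k = ?z'" | "window x (Suc m) k \<notin> ?Z"
      by blast
    then show "v \<in> butlast ` (?X - ?Z)"
    proof cases
      case 1
      then have "v = butlast (window x (Suc m) j)" using v eq by (simp add: window_Suc)
      moreover have "window x (Suc m) j \<notin> ?Z" using neq eq diff by (simp add: window_Suc)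
      ultimately show ?thesis by blast
    next
      case 2
      then have "v = butlast (window x (Suc m) j')" using v eq' by (simp add: window_Suc)
      moreover have "window x (Suc m) j' \<notin> ?Z" using neq' eq' diff by (simp add: window_Suc)
      ultimately show ?thesis by blast
    next
      case 3 then show ?thesis using v by blast
    qed
  qed
  from card_image_add_card_le[OF finite_windows[OF fin] _ this]
  have "card (range (window x m)) + card ?Z \<le> card ?X" by (simp add: butlast_windows)
  moreover have "card ?Z = 2" using diff by (simp add: window_Suc card_insert_if)
  ultimately show ?thesis by (simp add: word_complexity_eq_card_windows)
qed

text \<open>
  If deleting last letters identifies two words, then removing one of them leaves a surjection,
  which is a bijection because the cardinalities differ by one only. Every collision
  therefore involves the removed word.
\<close>

lemma growth_one_unique_branching:
  assumes fin: "finite (range x)"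
    and growth: "word_complexity (Suc n) x = word_complexity n x + 1"
  obtains i0 j0 where "window x n i0 = window x n j0" "x (i0 + int n) \<noteq> x (j0 + int n)"
    "\<And>i j. window x n i = window x n j \<Longrightarrow> x (i + int n) \<noteq> x (j + int n) \<Longrightarrow>
        window x n i = window x n i0"
    "\<And>i. window x n i = window x n i0 \<Longrightarrow>
        x (i + int n) = x (i0 + int n) \<or> x (i + int n) = x (j0 + int n)"
proof -
  let ?X = "range (window x (Suc n))"
  have finX: "finite ?X" by (rule finite_windows[OF fin])
  have card: "card ?X = card (butlast ` ?X) + 1"
    using growth by (simp add: word_complexity_eq_card_windows butlast_windows)
  then have "\<not> inj_on butlast ?X" using card_image[of butlast ?X] by linarith
  then obtain i0 j0 where ij: "window x (Suc n) i0 \<noteq> window x (Suc n) j0"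
    "butlast (window x (Suc n) i0) = butlast (window x (Suc n) j0)"
    by (auto simp: inj_on_def)
  then have eq: "window x n i0 = window x n j0" and neq: "x (i0 + int n) \<noteq> x (j0 + int n)"
    by (simp_all add: window_Suc)
  let ?z = "window x (Suc n) j0"
  have "butlast ?z \<in> butlast ` (?X - {?z})"
    using ij by (intro image_eqI[of _ _ "window x (Suc n) i0"]) auto
  then have "butlast ` (?X - {?z}) = butlast ` insert ?z (?X - {?z})"
    unfolding image_insert by (rule insert_absorb[symmetric])
  then have im: "butlast ` (?X - {?z}) = butlast ` ?X" by (simp add: insert_absorb)
  have "card (butlast ` (?X - {?z})) = card (?X - {?z})"
    unfolding im using card finX by simp
  then have inj: "inj_on butlast (?X - {?z})"
    by (intro eq_card_imp_inj_on) (use finX in auto)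
  have collide: "window x (Suc n) i = window x (Suc n) j"
    if "window x n i = window x n j" "window x (Suc n) i \<noteq> ?z" "window x (Suc n) j \<noteq> ?z" for i j
  proof (rule inj_onD[OF inj])
    show "butlast (window x (Suc n) i) = butlast (window x (Suc n) j)"
      using that(1) by (simp add: window_Suc)
  qed (use that(2,3) in blast)+
  show thesis
  proof (rule that[OF eq neq])
    fix i j assume "window x n i = window x n j" "x (i + int n) \<noteq> x (j + int n)"
    then have "window x (Suc n) i = ?z \<or> window x (Suc n) j = ?z"
      using collide[of i j] by (auto simp: window_Suc)
    then show "window x n i = window x n i0"
      using \<open>window x n i = window x n j\<close> eq by (auto simp: window_Suc)
  next
    fix i assume "window x n i = window x n i0"
    then show "x (i + int n) = x (i0 + int n) \<or> x (i + int n) = x (j0 + int n)"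
      using collide[of i i0] eq neq by (auto simp: window_Suc)
  qed
qed

section \<open>Determinism forces periodicity\<close>

text \<open>
  By the pigeonhole principle the orbit repeats a value within the first \<open>card (range f) + 1\<close> steps, so
  it has a period of at most \<open>card (range f)\<close>. The factorial is a multiple of all these candidates;
  having one period that depends neither on the block nor on its position is what permits
  left-infinite blocks, which have no starting point.
\<close>

lemma deterministic_block_periodic:
  fixes f :: "int \<Rightarrow> 'b"
  assumes fin: "finite (range f)"
    and det: "\<And>i j. s \<le> i \<Longrightarrow> i < e \<Longrightarrow> s \<le> j \<Longrightarrow> j < e \<Longrightarrow> f i = f j \<Longrightarrow> f (i + 1) = f (j + 1)"
    and t: "s + int (card (range f)) \<le> t" "t + fact (card (range f)) \<le> e"
  shows "f (t + fact (card (range f))) = f t"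
proof -
  let ?K = "card (range f)"
  have "\<not> inj_on f {s..s + int ?K}"
  proof
    assume "inj_on f {s..s + int ?K}"
    then have "card {s..s + int ?K} \<le> ?K"
      using fin by (intro card_inj_on_le[of f]) auto
    then show False by simp
  qed
  then obtain i0 j0 where "i0 \<in> {s..s + int ?K}" "j0 \<in> {s..s + int ?K}" "i0 \<noteq> j0" "f i0 = f j0"
    by (auto simp: inj_on_def)
  then obtain i j where ij: "s \<le> i" "i < j" "j \<le> s + int ?K" "f i = f j"
    by (cases "i0 < j0") (auto intro: that[of i0 j0] that[of j0 i0])
  define d where "d = j - i"
  have d: "0 < d" "d \<le> int ?K" using ij by (auto simp: d_def)
  have shift: "u + d \<le> e \<longrightarrow> f (u + d) = f u" if "i \<le> u" for u
    using that
  proof (induction u rule: int_ge_induct)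
    case base then show ?case using ij by (simp add: d_def)
  next
    case (step u)
    show ?case
    proof
      assume le: "u + 1 + d \<le> e"
      then have "f (u + d) = f u" using step by simp
      then have "f (u + d + 1) = f (u + 1)"
        using le d ij(1) step(1) by (intro det) auto
      then show "f (u + 1 + d) = f (u + 1)" by (simp add: ac_simps)
    qed
  qed
  have mult: "t + int m * d \<le> e \<longrightarrow> f (t + int m * d) = f t" for m
  proof (induction m)
    case (Suc m)
    show ?case
    proof
      assume le: "t + int (Suc m) * d \<le> e"
      have eq: "t + int (Suc m) * d = (t + int m * d) + d" by (simp add: algebra_simps)
      have le': "t + int m * d + d \<le> e" using le unfolding eq .
      have "i \<le> t + int m * d" using ij t d by (smt (verit) mult_nonneg_nonneg of_nat_0_le_iff)
      then have "f (t + int m * d + d) = f (t + int m * d)" using shift le' by blast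
      also have "\<dots> = f t" using Suc le' d by simp
      finally show "f (t + int (Suc m) * d) = f t" unfolding eq .
    qed
  qed simp
  have "nat d dvd fact ?K" by (rule dvd_fact) (use d in auto)
  then obtain m where "fact ?K = nat d * m" by blast
  then have "int (fact ?K) = int m * d" using d by (simp add: ac_simps)
  then have "fact ?K = int m * d" by (simp only: of_nat_fact)
  then show ?thesis using mult[of m] t by simp
qed

lemma deterministic_windows_left:
  assumes fin: "finite (range x)"
    and det: "\<And>i j. i < m \<Longrightarrow> j < m \<Longrightarrow> window x n i = window x n j \<Longrightarrow> x (i + int n) = x (j + int n)"
  obtains d where "0 < d" "\<And>t. t + d \<le> m \<Longrightarrow> window x n (t + d) = window x n t"
proof
  let ?K = "card (range (window x n))"
  show "(0::int) < fact ?K" by simp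
  fix t :: int assume "t + fact ?K \<le> m"
  then show "window x n (t + fact ?K) = window x n t"
    by (intro deterministic_block_periodic[where s = "t - int ?K" and e = m] finite_windows fin)
      (auto intro: window_step det)
qed

lemma deterministic_windows_right:
  assumes fin: "finite (range x)"
    and det: "\<And>i j. m \<le> i \<Longrightarrow> m \<le> j \<Longrightarrow> window x n i = window x n j \<Longrightarrow> x (i + int n) = x (j + int n)"
  obtains d l where "0 < d" "\<And>t. l \<le> t \<Longrightarrow> window x n (t + d) = window x n t"
proof
  let ?K = "card (range (window x n))"
  show "(0::int) < fact ?K" by simp
  fix t assume "m + int ?K \<le> t"
  then show "window x n (t + fact ?K) = window x n t"
    by (intro deterministic_block_periodic[where s = m and e = "t + fact ?K"] finite_windows fin)
      (auto intro: window_step det)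
qed

lemma window_eq_imp_letter_eq:
  assumes "window x n i = window x n j" "n \<ge> 1" shows "x i = x j"
  using assms by (auto simp: window_eq_iff dest: spec[of _ 0])

lemma eventually_periodic_right:
  fixes d :: int
  assumes "n \<ge> 1" "0 < d" "\<And>t. l \<le> t \<Longrightarrow> window x n (t + d) = window x n t"
  shows "eventually_periodic (\<lambda>k. x (int k))"
  unfolding eventually_periodic_def
proof (intro exI conjI allI impI)
  show "1 \<le> nat d" using assms(2) by simp
  show "1 \<le> nat (max 1 l)" by simp
  fix k assume "nat (max 1 l) < k"
  then have "window x n (int k + d) = window x n (int k)" by (intro assms(3)) auto
  then show "x (int k) = x (int (k + nat d))"
    using assms(1,2) by (auto dest: window_eq_imp_letter_eq)
qed

lemma eventually_periodic_left:
  fixes d :: int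
  assumes "n \<ge> 1" "0 < d" "\<And>t. t + d \<le> m \<Longrightarrow> window x n (t + d) = window x n t"
  shows "eventually_periodic (\<lambda>k. x (- int k))"
  unfolding eventually_periodic_def
proof (intro exI conjI allI impI)
  show "1 \<le> nat d" using assms(2) by simp
  show "1 \<le> nat (max 1 (- m))" by simp
  fix k assume "nat (max 1 (- m)) < k"
  then have "window x n (- int k - d + d) = window x n (- int k - d)" by (intro assms(3)) auto
  then have "x (- int k - d + d) = x (- int k - d)" using assms(1) by (rule window_eq_imp_letter_eq)
  moreover have "- int (k + nat d) = - int k - d" using assms(2) by simp
  ultimately show "x (- int k) = x (- int (k + nat d))" by simp
qed

text \<open>
  The bi-infinite form of the Morse--Hedlund theorem: without right special words of length \<open>n\<close> each window
  determines the next one.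
\<close>

lemma complexity_strictly_grows:
  assumes fin: "finite (range x)" and n: "n \<ge> 1"
    and nep: "\<not> eventually_periodic_both_directions x"
  shows "word_complexity n x + 1 \<le> word_complexity (Suc n) x"
proof (rule ccontr)
  assume "\<not> ?thesis"
  then have det: "x (i + int n) = x (j + int n)" if "window x n i = window x n j" for i j
    using complexity_growth_one[OF fin that] by blast
  obtain d where d: "0 < d" "\<And>t. t + d \<le> 0 \<Longrightarrow> window x n (t + d) = window x n t"
    using deterministic_windows_left[OF fin, of 0 n] det by metis
  obtain d' l where d': "0 < d'" "\<And>t. l \<le> t \<Longrightarrow> window x n (t + d') = window x n t"
    using deterministic_windows_right[OF fin, of 0 n] det by metis
  show False using nep eventually_periodic_left[OF n d] eventually_periodic_right[OF n d']
    by (simp add: eventually_periodic_both_directions_def)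
qed

section \<open>Lengths with a single branching\<close>

text \<open>
  The situation at a length where the complexity grows by exactly one: \<open>r\<close> is the only right
  special word. The letters \<open>a\<close> and \<open>b\<close> play symmetric roles, so that they can be exchanged later.
\<close>

locale single_branching =
  fixes x :: "int \<Rightarrow> 'a" and n :: nat and r :: "'a list" and a b :: 'a
  assumes fin: "finite (range x)" and n_pos: "n \<ge> 1"
    and nep: "\<not> eventually_periodic_both_directions x"
    and a_neq_b: "a \<noteq> b"
    and branch: "window x n i = window x n j \<Longrightarrow> x (i + int n) \<noteq> x (j + int n) \<Longrightarrow> window x n i = r"
    and letters: "window x n i = r \<Longrightarrow> x (i + int n) = a \<or> x (i + int n) = b"
    and occurs_a: "\<exists>i. window x n i = r \<and> x (i + int n) = a"
    and occurs_b: "\<exists>i. window x n i = r \<and> x (i + int n) = b"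
begin

abbreviation W :: "int \<Rightarrow> 'a list" where "W i \<equiv> window x n i"
abbreviation nxt :: "int \<Rightarrow> 'a" where "nxt i \<equiv> x (i + int n)"

text \<open>
  Before a first occurrence of \<open>r\<close> the windows would be deterministic, hence periodic, and the period
  would carry \<open>r\<close> to an earlier position.
\<close>

lemma r_unbounded_below: "\<exists>i<m. W i = r"
proof (rule ccontr)
  assume none: "\<not> ?thesis"
  obtain j where j: "W j = r" using occurs_a by blast
  have "m \<le> j" using none j by force
  define k where "k = (LEAST k. W (m + int k) = r)"
  have ex: "W (m + int (nat (j - m))) = r" using \<open>m \<le> j\<close> j by simp
  have k: "W (m + int k) = r" unfolding k_def by (rule LeastI, rule ex)
  have first: "W i \<noteq> r" if "i < m + int k" for i
  proof (cases "i < m")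
    case False
    then have "nat (i - m) < k" using that by simp
    then have "W (m + int (nat (i - m))) \<noteq> r" unfolding k_def by (rule not_less_Least)
    then show ?thesis using False by simp
  qed (use none in blast)
  obtain d where d: "0 < d" "\<And>t. t + d \<le> m + int k \<Longrightarrow> W (t + d) = W t"
    using deterministic_windows_left[OF fin, of "m + int k" n] branch first by metis
  show False using d(2)[of "m + int k - d"] first[of "m + int k - d"] k d(1) by simp
qed

lemma same_path:
  assumes "W i = W j" "nxt i = nxt j" "\<And>s. 0 < s \<Longrightarrow> s < k \<Longrightarrow> W (i + s) \<noteq> r"
    and s: "0 \<le> s" "s \<le> k"
  shows "W (i + s) = W (j + s)"
  using s
proof (induction s rule: int_ge_induct)
  case base then show ?case using assms by simp
next
  case (step s)
  then have eq: "W (i + s) = W (j + s)" by simp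
  have "nxt (i + s) = nxt (j + s)"
  proof (cases "s = 0")
    case False
    then have "0 < s" "s < k" using step by auto
    then have "W (i + s) \<noteq> r" by (rule assms(3))
    then show ?thesis using branch[OF eq] by blast
  qed (use assms(2) in simp)
  from window_step[OF eq this] show ?case by (simp add: add.assoc)
qed

text \<open>
  After a last occurrence of \<open>r\<close> the windows would be deterministic, and so periodic to the right. The letter
  chosen at that last occurrence leads to a path without return to \<open>r\<close>, so all earlier occurrences are
  followed by the other letter. Hence the windows are deterministic to the left as well,
  and \<open>x\<close> would be eventually periodic in both directions.
\<close>

lemma r_unbounded_above: "\<exists>i>m. W i = r"
proof (rule ccontr)
  assume none: "\<not> ?thesis"
  obtain j where j: "W j = r" using occurs_a by blast
  have "j \<le> m" using none j by force
  define k where "k = (LEAST k. W (m - int k) = r)"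
  have ex: "W (m - int (nat (m - j))) = r" using \<open>j \<le> m\<close> j by simp
  define i0 where "i0 = m - int k"
  have i0: "W i0 = r" unfolding i0_def k_def by (rule LeastI, rule ex)
  have last: "W i \<noteq> r" if "i0 < i" for i
  proof (cases "i > m")
    case False
    then have "nat (m - i) < k" using that by (simp add: i0_def)
    then have "W (m - int (nat (m - i))) \<noteq> r" unfolding k_def by (rule not_less_Least)
    then show ?thesis using False by simp
  qed (use none in blast)
  have other: "nxt i \<noteq> nxt i0" if "i < i0" "W i = r" for i
  proof
    assume "nxt i = nxt i0"
    then have "W (i0 + (i0 - i)) = W (i + (i0 - i))"
      by (intro same_path[where k = "i0 - i"]) (use that i0 last in auto)
    then show False using last[of "i0 + (i0 - i)"] that i0 by simp
  qed
  have "nxt i = nxt j" if "i < i0" "j < i0" "W i = W j" for i j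
  proof (rule ccontr)
    assume neq: "nxt i \<noteq> nxt j"
    then have "W i = r" using branch that by blast
    then show False using neq other letters i0 that by metis
  qed
  then obtain d where d: "0 < d" "\<And>t. t + d \<le> i0 \<Longrightarrow> W (t + d) = W t"
    using deterministic_windows_left[OF fin, of i0 n] by metis
  have "nxt i = nxt j" if "i0 + 1 \<le> i" "i0 + 1 \<le> j" "W i = W j" for i j
    using branch[OF that(3)] last[of i] that by force
  then obtain d' l where d': "0 < d'" "\<And>t. l \<le> t \<Longrightarrow> W (t + d') = W t"
    using deterministic_windows_right[OF fin, of "i0 + 1" n] by metis
  show False
    using nep eventually_periodic_left[OF n_pos d] eventually_periodic_right[OF n_pos d']
    by (simp add: eventually_periodic_both_directions_def)
qed

text \<open>
  The length of the loop from \<open>r\<close> to its next occurrence that starts with the letter \<open>c\<close>; by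
  determinism it is the same at all occurrences.
\<close>

definition ret :: "'a \<Rightarrow> int" where
  "ret c = int (LEAST k. 0 < k \<and> (\<exists>i. W i = r \<and> nxt i = c \<and> W (i + int k) = r))"

lemma
  assumes i: "W i = r"
  shows ret_pos: "0 < ret (nxt i)"
    and W_ret: "W (i + ret (nxt i)) = r"
    and W_before_ret: "0 < s \<Longrightarrow> s < ret (nxt i) \<Longrightarrow> W (i + s) \<noteq> r"
proof -
  let ?P = "\<lambda>k. 0 < k \<and> (\<exists>j. W j = r \<and> nxt j = nxt i \<and> W (j + int k) = r)"
  obtain i' where "i < i'" "W i' = r" using r_unbounded_above by blast
  then have "?P (nat (i' - i))" using i by (auto intro!: exI[of _ i])
  from LeastI[of ?P, OF this]
  have "0 < ret (nxt i)" "\<exists>j. W j = r \<and> nxt j = nxt i \<and> W (j + ret (nxt i)) = r"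
    by (auto simp: ret_def)
  then obtain j where pos: "0 < ret (nxt i)" and j: "W j = r" "nxt j = nxt i" "W (j + ret (nxt i)) = r"
    by blast
  have before: "W (j' + s) \<noteq> r"
    if "0 < s" "s < ret (nxt i)" "W j' = r" "nxt j' = nxt i" for s j'
  proof -
    have "\<not> ?P (nat s)" by (rule not_less_Least) (use that in \<open>simp add: ret_def zless_nat_eq_int_zless nat_less_iff\<close>)
    then show ?thesis using that by auto
  qed
  show "0 < ret (nxt i)" by (rule pos)
  show "W (i + s) \<noteq> r" if "0 < s" "s < ret (nxt i)" for s
    using before that i by blast
  have "W (i + ret (nxt i)) = W (j + ret (nxt i))"
    by (rule same_path[where k = "ret (nxt i)"]) (use i j before pos in auto)
  then show "W (i + ret (nxt i)) = r" using j by simp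
qed

lemma same_loop:
  assumes "W i = r" "W j = r" "nxt i = nxt j" "0 \<le> s" "s \<le> ret (nxt i)"
  shows "W (i + s) = W (j + s)"
  by (rule same_path[where k = "ret (nxt i)"]) (use assms W_before_ret in auto)

lemma in_loop:
  obtains i where "W i = r" "i \<le> t" "t < i + ret (nxt i)"
proof -
  obtain j where j: "j < t" "W j = r" using r_unbounded_below by blast
  define k where "k = (LEAST k. W (t - int k) = r)"
  have ex: "W (t - int (nat (t - j))) = r" using j by simp
  have k: "W (t - int k) = r" unfolding k_def by (rule LeastI, rule ex)
  have none: "W i \<noteq> r" if "t - int k < i" "i \<le> t" for i
  proof -
    have "nat (t - i) < k" using that by simp
    then have "W (t - int (nat (t - i))) \<noteq> r" unfolding k_def by (rule not_less_Least)
    then show ?thesis using that by simp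
  qed
  show thesis
  proof (rule that[OF k])
    show "t < t - int k + ret (nxt (t - int k))"
      using none[of "t - int k + ret (nxt (t - int k))"] W_ret[OF k] ret_pos[OF k] by linarith
  qed simp
qed

lemma previous_r:
  assumes "W j = r"
  obtains i where "W i = r" "j = i + ret (nxt i)"
proof -
  obtain i where i: "W i = r" "i \<le> j - 1" "j - 1 < i + ret (nxt i)" by (rule in_loop)
  then have "j = i + ret (nxt i)" using W_before_ret[OF i(1), of "j - i"] assms by force
  then show thesis using that i by blast
qed

text \<open>
  If a window repeated inside a loop, the path from its second occurrence would reach \<open>r\<close> at the end of the loop;
  the path from the first occurrence would copy it and reach \<open>r\<close> too early.
\<close>

lemma inj_on_loop:
  assumes "W i = r"
  shows "inj_on W {i..<i + ret (nxt i)}"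
proof -
  let ?q = "ret (nxt i)"
  have "W u \<noteq> W v" if uv: "i \<le> u" "u < v" "v < i + ?q" for u v
  proof
    assume eq: "W u = W v"
    have v: "W v \<noteq> r" using W_before_ret[OF assms, of "v - i"] uv by simp
    then have "nxt v = nxt u" using branch[OF eq] eq by metis
    moreover have "W (v + s) \<noteq> r" if "0 < s" "s < i + ?q - v" for s
      using W_before_ret[OF assms, of "v + s - i"] that uv by simp
    ultimately have "W (v + (i + ?q - v)) = W (u + (i + ?q - v))"
      by (intro same_path[where k = "i + ?q - v"]) (use eq uv in auto)
    then have "W (u + (i + ?q - v)) = r" using W_ret[OF assms] by simp
    then show False using W_before_ret[OF assms, of "u + ?q - v"] uv by (simp add: algebra_simps)
  qed
  then show ?thesis
    by (intro inj_onI) (metis atLeastLessThan_iff linorder_cases)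
qed

lemma complexity_ge_ret:
  assumes "W i = r"
  shows "ret (nxt i) \<le> int (word_complexity n x)"
proof -
  have "card {i..<i + ret (nxt i)} \<le> card (range W)"
    by (intro card_inj_on_le[OF inj_on_loop[OF assms]] finite_windows fin) auto
  then show ?thesis by (simp add: word_complexity_eq_card_windows)
qed

end

section \<open>Runs of the periodic loop, and excursions\<close>

text \<open>
  The word \<open>w\<close> breaks the symmetry between the two loops: a passage through the one that meets it
  is an excursion, and the stretches without \<open>w\<close> provided by \<open>gaps\<close> have room for none.
\<close>

locale excursions = single_branching +
  fixes w :: "'a list"
  assumes w_le: "length w \<le> n" and w_pos: "w \<noteq> []"
    and gaps: "\<exists>s. \<forall>t. s \<le> t \<and> t \<le> s + N \<longrightarrow> window x (length w) t \<noteq> w"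
    and free_a: "W i = r \<Longrightarrow> nxt i = a \<Longrightarrow> 0 \<le> s \<Longrightarrow> s < ret a \<Longrightarrow> window x (length w) (i + s) \<noteq> w"
    and meets_b: "W i = r \<Longrightarrow> nxt i = b \<Longrightarrow> \<exists>s. 0 \<le> s \<and> s < ret b \<and> window x (length w) (i + s) = w"
begin

abbreviation occ :: "int \<Rightarrow> bool" where "occ t \<equiv> window x (length w) t = w"
abbreviation A :: "int \<Rightarrow> bool" where "A i \<equiv> W i = r \<and> nxt i = a"
abbreviation B :: "int \<Rightarrow> bool" where "B i \<equiv> W i = r \<and> nxt i = b"
abbreviation p :: int where "p \<equiv> ret a"
abbreviation q :: int where "q \<equiv> ret b"

lemma p_pos: "0 < p" using occurs_a ret_pos by metis
lemma q_pos: "0 < q" using occurs_b ret_pos by metis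

definition run :: "int \<Rightarrow> nat \<Rightarrow> bool" where
  "run i k \<longleftrightarrow> W i = r \<and> (\<forall>l<k. A (i + int l * p))"

lemma run_0 [simp]: "run i 0 \<longleftrightarrow> W i = r" by (simp add: run_def)

lemma run_end:
  assumes "run i k" shows "W (i + int k * p) = r"
proof (cases k)
  case (Suc l)
  then have l: "A (i + int l * p)" using assms by (simp add: run_def)
  then show ?thesis using W_ret[of "i + int l * p"] Suc by (simp add: algebra_simps)
qed (use assms in \<open>simp add: run_def\<close>)

lemma run_Suc: "run i (Suc k) \<longleftrightarrow> run i k \<and> A (i + int k * p)"
  by (auto simp: run_def less_Suc_eq)

lemma run_Suc_front:
  assumes "A i" "run (i + p) k" shows "run i (Suc k)"
  unfolding run_def
proof (intro conjI allI impI)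
  fix l assume "l < Suc k"
  have "A (i + int l * p)"
  proof (cases l)
    case (Suc l')
    then have "A (i + p + int l' * p)" using assms \<open>l < Suc k\<close> by (simp add: run_def)
    moreover have "i + p + int l' * p = i + int l * p" using Suc by (simp add: algebra_simps)
    ultimately show ?thesis by simp
  qed (use assms in simp)
  then show "W (i + int l * p) = r" "nxt (i + int l * p) = a" by blast+
qed (use assms in simp)

lemma run_return:
  assumes run: "run i k" and j: "i \<le> j" "j < i + int k * p" "W j = r"
  obtains l where "l < k" "j = i + int l * p"
proof -
  define l where "l = nat ((j - i) div p)"
  define s where "s = (j - i) mod p"
  have l0: "int l = (j - i) div p" using j p_pos by (simp add: l_def pos_imp_zdiv_nonneg_iff)
  then have eq: "j = i + int l * p + s" by (simp add: s_def)
  have s: "0 \<le> s" "s < p" using p_pos by (auto simp: s_def)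
  have "int l * p < int k * p" using eq s j by linarith
  then have lk: "l < k" using p_pos by simp
  then have "A (i + int l * p)" using run by (simp add: run_def)
  then have "s = 0" using W_before_ret[of "i + int l * p" s] s j(3) eq by force
  then show thesis using that lk eq by simp
qed

lemma run_path:
  assumes "run i k" "run j k" "0 \<le> s" "s \<le> int k * p"
  shows "W (i + s) = W (j + s)"
proof (cases "s = int k * p")
  case True
  then show ?thesis using run_end assms by simp
next
  case False
  define l where "l = nat (s div p)"
  have l0: "int l = s div p" using assms p_pos by (simp add: l_def pos_imp_zdiv_nonneg_iff)
  have s: "s = int l * p + s mod p" "0 \<le> s mod p" "s mod p < p" using p_pos l0 by auto
  have "int l * p < int k * p" using s False assms by linarith
  then have "l < k" using p_pos by simp
  then have "A (i + int l * p)" "A (j + int l * p)" using assms by (auto simp: run_def)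
  then have "W ((i + int l * p) + s mod p) = W ((j + int l * p) + s mod p)"
    using s by (intro same_loop) auto
  then show ?thesis using s(1) by (simp add: add.assoc)
qed

text \<open>
  A long stretch without \<open>w\<close> has no room for an excursion, so it consists of loops at \<open>a\<close>.
\<close>

lemma long_runs: "\<exists>i. run i k"
proof -
  define N where "N = p + int k * p + q"
  obtain s where s: "\<And>t. s \<le> t \<Longrightarrow> t \<le> s + (N + q) \<Longrightarrow> \<not> occ t" using gaps[of "N + q"] by blast
  obtain i where i: "W i = r" "i \<le> s" "s < i + ret (nxt i)" by (rule in_loop)
  define j where "j = i + ret (nxt i)"
  have j: "W j = r" "s \<le> j" "j \<le> s + p + q"
    using W_ret[OF i(1)] i letters[OF i(1)] p_pos q_pos by (auto simp: j_def)
  have "l \<le> k \<Longrightarrow> run j l" for l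
  proof (induction l)
    case (Suc l)
    then have run: "run j l" by simp
    let ?u = "j + int l * p"
    have u: "W ?u = r" by (rule run_end[OF run])
    have "int l * p \<le> int k * p" using Suc p_pos by simp
    moreover have "0 \<le> int l * p" using p_pos by simp
    ultimately have "\<not> occ (?u + t)" if "0 \<le> t" "t < q" for t
      using that j by (intro s) (auto simp: N_def)
    then have "nxt ?u \<noteq> b" using meets_b[OF u] by blast
    then show ?case using run u letters by (auto simp: run_Suc)
  qed (use j in simp)
  then show ?thesis by blast
qed

lemma run_free:
  assumes "run i k" "i \<le> t" "t < i + int k * p" shows "\<not> occ t"
proof -
  define l where "l = nat ((t - i) div p)"
  have l0: "int l = (t - i) div p" using assms p_pos by (simp add: l_def pos_imp_zdiv_nonneg_iff)
  have s: "t = i + int l * p + (t - i) mod p" "0 \<le> (t - i) mod p" "(t - i) mod p < p"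
    using p_pos l0 by auto
  have "int l * p < int k * p" using s assms by linarith
  then have "l < k" using p_pos by simp
  then have "A (i + int l * p)" using assms by (auto simp: run_def)
  then show ?thesis using free_a[of "i + int l * p" "(t - i) mod p"] s by metis
qed

text \<open>
  Since \<open>p \<ge> 1\<close>, a run of \<open>n\<close> loops is long enough to cover an occurrence of \<open>r\<close>.
\<close>

lemma r_free:
  assumes "W i = r" "i \<le> t" "t + int (length w) \<le> i + int n" shows "\<not> occ t"
proof -
  obtain j where j: "run j n" using long_runs by blast
  then have "W j = r" by (simp add: run_def)
  then have eq: "window x (length w) (i + (t - i)) = window x (length w) (j + (t - i))"
    using assms by (intro window_sub[where n = n]) auto
  have "length w > 0" using w_pos by simp
  then have "t - i < int n" using assms by linarith
  also have "int n * 1 \<le> int n * p" using p_pos by (intro mult_left_mono) auto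
  finally have "\<not> occ (j + (t - i))"
    using assms by (intro run_free[OF j]) auto
  then show ?thesis using eq by simp
qed

lemma occ_in_excursion:
  assumes "occ t"
  obtains i where "B i" "i + int n - int (length w) < t" "t < i + q"
proof -
  obtain i where i: "W i = r" "i \<le> t" "t < i + ret (nxt i)" by (rule in_loop)
  have "nxt i \<noteq> a" using free_a[OF i(1), of "t - i"] i assms by auto
  then have "nxt i = b" using letters i by blast
  moreover have "i + int n - int (length w) < t" using r_free[OF i(1), of t] i assms by force
  ultimately show thesis using that i by auto
qed

text \<open>
  If \<open>q \<le> n + T\<close>, then by \<open>occ_in_excursion\<close> the occurrences of \<open>w\<close> in one excursion spread over less than
  \<open>T + |w|\<close>. Those of two different excursions are separated by the second copy of \<open>r\<close>, which is free of \<open>w\<close>,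
  hence by more than \<open>n - |w|\<close>. A pair at an intermediate distance is impossible.
\<close>

lemma excursion_long:
  assumes "occ t" "occ t'" "T + int (length w) \<le> t' - t" "t' - t + int (length w) \<le> int n" "0 \<le> T"
  shows "int n + T < q"
proof -
  obtain i where i: "B i" "i + int n - int (length w) < t" "t < i + q"
    by (rule occ_in_excursion[OF assms(1)])
  obtain i' where i': "B i'" "i' + int n - int (length w) < t'" "t' < i' + q"
    by (rule occ_in_excursion[OF assms(2)])
  have i_le: "i \<le> t" "i' \<le> t'" using i i' w_le by linarith+
  have "\<not> i' < i" using W_before_ret[of i' "i - i'"] i i' i_le assms by force
  moreover have "\<not> i < i'"
  proof
    assume "i < i'"
    then have "i + q \<le> i'" using W_before_ret[of i "i' - i"] i i' by force
    then show False using i i' assms by linarith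
  qed
  ultimately have "i = i'" by simp
  then show ?thesis using i i' assms by linarith
qed

text \<open>
  Beyond all excursions only the letter \<open>a\<close> follows \<open>r\<close>, so the windows are deterministic there.
\<close>

lemma excursions_unbounded: "(\<forall>m. \<exists>i>m. B i) \<or> (\<forall>m. \<exists>i<m. B i)"
proof (rule ccontr)
  assume "\<not> ?thesis"
  then obtain m m' where m: "\<And>i. i > m \<Longrightarrow> \<not> B i" and m': "\<And>i. i < m' \<Longrightarrow> \<not> B i"
    by blast
  have "nxt i = nxt j" if "m + 1 \<le> i" "m + 1 \<le> j" "W i = W j" for i j
  proof -
    have "\<not> B i" "\<not> B j" using m[of i] m[of j] that by linarith+
    then show ?thesis using branch[OF that(3)] letters that(3) by metis
  qed
  then obtain d l where d: "0 < d" "\<And>t. l \<le> t \<Longrightarrow> W (t + d) = W t"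
    using deterministic_windows_right[OF fin, of "m + 1" n] by metis
  have "nxt i = nxt j" if "i < m'" "j < m'" "W i = W j" for i j
    using branch[OF that(3)] letters m'[OF that(1)] m'[OF that(2)] that(3) by metis
  then obtain d' where d': "0 < d'" "\<And>t. t + d' \<le> m' \<Longrightarrow> W (t + d') = W t"
    using deterministic_windows_left[OF fin, of m' n] by metis
  show False
    using nep eventually_periodic_left[OF n_pos d'] eventually_periodic_right[OF n_pos d]
    by (simp add: eventually_periodic_both_directions_def)
qed

lemma occ_spread: "\<exists>t t'. occ t \<and> occ t' \<and> T \<le> t' - t"
proof -
  have near: "\<exists>t. i \<le> t \<and> t < i + q \<and> occ t" if "B i" for i
    using meets_b[of i] that by (force intro: exI[of _ "i + _"])
  obtain i where i: "B i" using occurs_b by blast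
  obtain t where t: "i \<le> t" "t < i + q" "occ t" using near[OF i] by blast
  from excursions_unbounded show ?thesis
  proof
    assume "\<forall>m. \<exists>i>m. B i"
    then obtain j where "j > t + T" "B j" by blast
    then show ?thesis using near[of j] t by force
  next
    assume "\<forall>m. \<exists>i<m. B i"
    then obtain j where "j < t - T - q" "B j" by blast
    then obtain t' where "t' < j + q" "occ t'" using near[of j] by blast
    then show ?thesis using t \<open>j < t - T - q\<close> by (intro exI[of _ t'] exI[of _ t]) auto
  qed
qed

section \<open>Shortest runs between excursions\<close>

definition exact_run :: "int \<Rightarrow> nat \<Rightarrow> bool" where
  "exact_run i k \<longleftrightarrow> B i \<and> run (i + q) k \<and> B (i + q + int k * p)"

lemma run_after_excursion: "B i \<Longrightarrow> run (i + q) 0"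
  using W_ret[of i] by simp

lemma extend_run:
  assumes "B i" "run (i + q) k" "\<not> exact_run i k" shows "run (i + q) (Suc k)"
  using assms run_end[OF assms(2)] letters by (auto simp: run_Suc exact_run_def)

lemma ex_exact_run: "\<exists>k i. exact_run i k"
proof (rule ccontr)
  assume none: "\<not> ?thesis"
  obtain i where i: "B i" using occurs_b by blast
  obtain i1 i2 where B: "B i1" "B i2" "i1 < i2" using excursions_unbounded i by blast
  have run: "run (i1 + q) k" for k
    by (induction k) (use B none extend_run run_after_excursion in blast)+
  have "i1 + q \<le> i2" using W_before_ret[of i1 "i2 - i1"] B by force
  define m where "m = nat (i2 - i1)"
  have "int m * 1 \<le> int m * p" using p_pos by (intro mult_left_mono) auto
  moreover have "int m = i2 - i1" using B by (simp add: m_def)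
  ultimately have "i2 < i1 + q + int m * p" using q_pos by linarith
  then obtain l where "i2 = i1 + q + int l * p" "l < m"
    using run_return[OF run \<open>i1 + q \<le> i2\<close>] B by blast
  then have "A i2" using run[of m] by (simp add: run_def)
  then show False using B a_neq_b by simp
qed

definition min_run :: nat where "min_run = (LEAST k. \<exists>i. exact_run i k)"

lemma exact_run_min_run: "\<exists>i. exact_run i min_run"
  unfolding min_run_def using ex_exact_run by (rule LeastI_ex)

lemma no_shorter_run: "k < min_run \<Longrightarrow> \<not> exact_run i k"
  unfolding min_run_def using not_less_Least by blast

lemma run_after:
  assumes "B i" shows "run (i + q) min_run"
proof -
  have "k \<le> min_run \<Longrightarrow> run (i + q) k" for k
  proof (induction k)
    case (Suc k)
    then show ?case using extend_run[OF assms] no_shorter_run[of k i] by simp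
  qed (use run_after_excursion assms in blast)
  then show ?thesis by blast
qed

text \<open>
  Going back from an excursion, the preceding loops are at \<open>a\<close> until an earlier excursion is met,
  which by minimality cannot happen within fewer than \<open>min_run\<close> loops.
\<close>

lemma run_before:
  assumes "B i" shows "run (i - int min_run * p) min_run"
proof -
  have "k \<le> min_run \<Longrightarrow> run (i - int k * p) k" for k
  proof (induction k)
    case (Suc k)
    let ?j = "i - int k * p"
    have run: "run ?j k" using Suc by simp
    then have "W ?j = r" by (simp add: run_def)
    then obtain u where u: "W u = r" "?j = u + ret (nxt u)" by (rule previous_r)
    show ?case
    proof (cases "nxt u = b")
      case True
      then have "?j = u + q" using u by simp
      then have "run (u + q) k" "i = u + q + int k * p" using run by simp_all
      then have "exact_run u k" using True u(1) assms unfolding exact_run_def by blast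
      then show ?thesis using no_shorter_run Suc by simp
    next
      case False
      then have a: "nxt u = a" using letters u by blast
      then have "u + p = ?j" using u by simp
      then have "run (u + p) k" using run by metis
      then have "run u (Suc k)" using run_Suc_front u a by blast
      moreover have "u = i - int (Suc k) * p" using \<open>u + p = ?j\<close> by (simp add: algebra_simps)
      ultimately show ?thesis by simp
    qed
  qed (use assms in simp)
  then show ?thesis by blast
qed

lemma common_path:
  assumes "B i" "B j" and s: "- int min_run * p \<le> s" "s \<le> q + int min_run * p"
  shows "W (i + s) = W (j + s)"
proof -
  consider "s \<le> 0" | "0 < s" "s \<le> q" | "q < s" by linarith
  then show ?thesis
  proof cases
    case 1
    then have "W ((i - int min_run * p) + (s + int min_run * p)) = W ((j - int min_run * p) + (s + int min_run * p))"
      using s by (intro run_path[where k = min_run] run_before assms) auto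
    then show ?thesis by simp
  next
    case 2
    then show ?thesis using assms by (intro same_loop) auto
  next
    case 3
    then have "W ((i + q) + (s - q)) = W ((j + q) + (s - q))"
      using s by (intro run_path[where k = min_run] run_after assms) auto
    then show ?thesis by simp
  qed
qed

text \<open>
  Otherwise each excursion is followed by exactly \<open>min_run\<close> loops and another excursion, which
  makes \<open>x\<close> periodic to the right. A run of \<open>min_run + 1\<close> loops then has no excursion before it,
  so that \<open>x\<close> is periodic to the left as well.
\<close>

lemma longer_run: "\<exists>i. B i \<and> A (i + q + int min_run * p)"
proof (rule ccontr)
  assume none: "\<not> ?thesis"
  let ?c = "q + int min_run * p"
  have c_pos: "0 < ?c" using p_pos q_pos by (simp add: add_pos_nonneg)
  have step: "B (i + ?c)" if "B i" for i
  proof -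
    have "W (i + q + int min_run * p) = r" by (rule run_end[OF run_after[OF that]])
    moreover from this have "nxt (i + q + int min_run * p) = b" using letters none that by blast
    ultimately show ?thesis by (simp add: add.assoc)
  qed
  have chain: "B (i + int k * ?c)" if "B i" for i k
  proof (induction k)
    case (Suc k)
    then show ?case using step[of "i + int k * ?c"] by (simp add: algebra_simps)
  qed (use that in simp)
  have locate: "\<exists>i' s. B i' \<and> 0 \<le> s \<and> s < ?c \<and> j = i' + s" if "B i" "i \<le> j" for i j
  proof (intro exI conjI)
    let ?k = "nat ((j - i) div ?c)"
    have k: "int ?k = (j - i) div ?c" using that c_pos by (simp add: pos_imp_zdiv_nonneg_iff)
    show "W (i + int ?k * ?c) = r" "nxt (i + int ?k * ?c) = b"
      using chain[of i ?k] that by auto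
    show "0 \<le> (j - i) mod ?c" "(j - i) mod ?c < ?c" using c_pos by auto
    show "j = i + int ?k * ?c + (j - i) mod ?c"
      using div_mult_mod_eq[of "j - i" ?c] unfolding k by linarith
  qed
  obtain i where i: "B i" using occurs_b by blast
  have "W (t + ?c) = W t" if t: "i \<le> t" for t
  proof -
    obtain i' s where i': "B i'" "0 \<le> s" "s < ?c" "t = i' + s" using locate[OF i t] by blast
    have "W (i' + ?c + s) = W (i' + s)"
      using i' step[OF i'(1)] p_pos by (intro common_path) (auto simp: order_trans[of _ 0])
    then show ?thesis using i' by (simp add: ac_simps)
  qed
  from eventually_periodic_right[OF n_pos c_pos this]
  have right: "eventually_periodic (\<lambda>k. x (int k))" .
  obtain j where j: "run j (Suc min_run)" using long_runs by blast
  have "\<not> B i" if "i < j" for i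
  proof
    assume "B i"
    moreover have "i \<le> j" using that by simp
    ultimately obtain i' s where i': "B i'" "0 \<le> s" "s < ?c" "j = i' + s"
      using locate[of i j] by blast
    have "A (j + int 0 * p)" using j zero_less_Suc unfolding run_def by blast
    then have Aj: "A j" by simp
    have "s \<noteq> 0"
    proof
      assume "s = 0"
      then have "A i'" using Aj i'(4) by simp
      then show False using i'(1) a_neq_b by simp
    qed
    have "q \<le> s"
    proof (rule ccontr)
      assume "\<not> q \<le> s"
      then have "W (i' + s) \<noteq> r"
        using W_before_ret[of i' s] i'(1,2) \<open>s \<noteq> 0\<close> by simp
      then show False using Aj i'(4) by simp
    qed
    then have "i' + q \<le> j" "j < i' + q + int min_run * p" using i' by linarith+
    then obtain l where l: "l < min_run" "j = i' + q + int l * p"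
      using run_return[OF run_after[OF i'(1)], of j] Aj by blast
    have "min_run - l < Suc min_run" by simp
    then have "A (j + int (min_run - l) * p)" using j unfolding run_def by blast
    moreover have "j + int (min_run - l) * p = i' + ?c"
      using l by (simp add: of_nat_diff algebra_simps)
    ultimately show False using step[OF i'(1)] a_neq_b by simp
  qed
  then have "nxt u = nxt v" if "u < j" "v < j" "W u = W v" for u v
    using branch[OF that(3)] letters that by metis
  then obtain d where d: "0 < d" "\<And>t. t + d \<le> j \<Longrightarrow> W (t + d) = W t"
    using deterministic_windows_left[OF fin, of j n] by metis
  show False using nep right eventually_periodic_left[OF n_pos d]
    by (simp add: eventually_periodic_both_directions_def)
qed

text \<open>
  The long right special word: all excursions agree from \<open>min_run\<close> loops before them to the end of the
  copy of \<open>r\<close> that closes the \<open>min_run\<close> loops after them. Taking one excursion with a shortest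
  run after it and one with a longer run makes the next letters differ.
\<close>

lemma excursion_branching:
  obtains i j where "B i" "x (i + q + int min_run * p + int n) \<noteq> x (j + q + int min_run * p + int n)"
    "\<And>s. - int min_run * p \<le> s \<Longrightarrow> s < q + int min_run * p + int n \<Longrightarrow> x (i + s) = x (j + s)"
proof -
  obtain i where i: "B i" "B (i + q + int min_run * p)"
    using exact_run_min_run by (auto simp: exact_run_def)
  obtain j where j: "B j" "A (j + q + int min_run * p)" using longer_run by blast
  show thesis
  proof (rule that[of i j])
    fix s assume s: "- int min_run * p \<le> s" "s < q + int min_run * p + int n"
    show "x (i + s) = x (j + s)"
    proof (cases "s \<le> q + int min_run * p")
      case True
      then show ?thesis
        using common_path[OF i(1) j(1), of s] s n_pos by (auto dest: window_eq_imp_letter_eq)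
    next
      case False
      have "0 \<le> int min_run * p" using p_pos by simp
      then have le: "- int min_run * p \<le> q + int min_run * p" using q_pos by linarith
      have "W (i + (q + int min_run * p)) = W (j + (q + int min_run * p))"
        by (rule common_path[OF i(1) j(1) le order_refl])
      then have "x (i + (q + int min_run * p) + k) = x (j + (q + int min_run * p) + k)"
        if "0 \<le> k" "k < int n" for k using that by (simp add: window_eq_iff)
      from this[of "s - (q + int min_run * p)"] show ?thesis using s False by simp
    qed
  qed (use i j a_neq_b in auto)
qed

text \<open>
  The common word of \<open>excursion_branching\<close> has length \<open>M - 1\<close>, and its suffix of length \<open>J\<close> starts at an occurrence of \<open>w\<close>.
  From length \<open>J\<close> on, its suffixes differ from the \<open>w\<close>-free right special words given by the assumption.
\<close>

lemma complexity_large: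
  assumes free_branching: "\<And>m. \<exists>i j. window x m i = window x m j \<and> x (i + int m) \<noteq> x (j + int m) \<and>
      (\<forall>t. i \<le> t \<and> t + int (length w) \<le> i + int m \<longrightarrow> \<not> occ t)"
  shows "\<exists>M\<ge>n. real (word_complexity M x) - 1.5 * real M \<ge> 0.5 * of_int (q - int n) - real (length w)"
proof -
  obtain i j where i: "B i" and neq: "x (i + q + int min_run * p + int n) \<noteq> x (j + q + int min_run * p + int n)"
    and eq: "\<And>s. - int min_run * p \<le> s \<Longrightarrow> s < q + int min_run * p + int n \<Longrightarrow> x (i + s) = x (j + s)"
    by (rule excursion_branching) blast
  obtain s where s: "0 \<le> s" "s < q" "occ (i + s)" using meets_b[of i] i by blast
  \<comment> \<open>An occurrence of \<open>w\<close> must stick out of \<open>r\<close>, so it starts late and \<open>J\<close> is small.\<close>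
  have s_n: "int n - int (length w) < s" using r_free[of i "i + s"] i s by force
  have gp: "0 \<le> int min_run * p" "0 \<le> p * int min_run" using p_pos by simp_all
  \<comment> \<open>Relative to the start of the excursion, the common word ends at \<open>e\<close> and \<open>w\<close> occurs at \<open>s\<close>.\<close>
  define e where "e = q + int min_run * p + int n"
  define M where "M = nat (e + int min_run * p + 1)"
  define J where "J = nat (e - s)"
  have M: "int M = e + int min_run * p + 1" and J: "int J = e - s"
    using gp s q_pos by (auto simp: M_def J_def e_def)
  have nJ: "n \<le> J" using J s gp by (simp add: e_def)
  have JM: "J \<le> M" using M J s gp by linarith
  let ?c = "\<lambda>m. word_complexity m x"
  have one: "?c m + 1 \<le> ?c (Suc m)" for m
    using free_branching[of m] complexity_growth_one[OF fin] by blast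
  have two: "?c m + 2 \<le> ?c (Suc m)" if m: "J \<le> m" "m < M" for m
  proof -
    obtain u v where uv: "window x m u = window x m v" "x (u + int m) \<noteq> x (v + int m)"
      and u: "\<And>t. u \<le> t \<Longrightarrow> t + int (length w) \<le> u + int m \<Longrightarrow> \<not> occ t"
      using free_branching[of m] by blast
    let ?i = "i + (e - int m)" and ?j = "j + (e - int m)"
    have eq': "window x m ?i = window x m ?j"
      unfolding window_eq_iff
    proof (intro allI impI)
      fix k assume k: "0 \<le> k \<and> k < int m"
      have "x (i + (e - int m + k)) = x (j + (e - int m + k))"
        using k m M by (intro eq) (auto simp: e_def)
      then show "x (?i + k) = x (?j + k)" by (simp add: add.assoc)
    qed
    have neq': "x (?i + int m) \<noteq> x (?j + int m)" using neq by (simp add: e_def add.assoc)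
    have "window x m ?i \<noteq> window x m u"
    proof
      assume *: "window x m ?i = window x m u"
      define t where "t = int m - e + s"
      have "t + int (length w) \<le> int m" "0 \<le> t"
        using s m J w_le gp by (auto simp: t_def e_def)
      moreover from window_sub[OF * this(2,1)] have "occ (u + t)"
        using s(3) by (simp add: t_def)
      ultimately show False using u[of "u + t"] by simp
    qed
    then show ?thesis using complexity_growth_two[OF fin eq' neq' uv] by blast
  qed
  have "?c n + k \<le> ?c (n + k)" for k
  proof (induction k)
    case (Suc k) then show ?case using one[of "n + k"] by simp
  qed simp
  from this[of "J - n"] have cJ: "?c n + (J - n) \<le> ?c J" using nJ by simp
  have "J + k \<le> M \<Longrightarrow> ?c J + 2 * k \<le> ?c (J + k)" for k
  proof (induction k)
    case (Suc k) then show ?case using two[of "J + k"] by simp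
  qed simp
  from this[of "M - J"] have cM: "?c J + 2 * (M - J) \<le> ?c M" using JM by simp
  have "q \<le> int (?c n)" using complexity_ge_ret[of i] i by simp
  then have "q + (int J - int n) + 2 * (int M - int J) \<le> int (?c M)"
    using cJ cM unfolding of_nat_diff[OF nJ, symmetric] of_nat_diff[OF JM, symmetric] by linarith
  then have "2 * int (?c M) - 3 * int M \<ge> (q - int n) - 2 * int (length w)"
    using M J s_n by (simp add: e_def)
  then have "real_of_int (2 * int (?c M) - 3 * int M) \<ge> real_of_int ((q - int n) - 2 * int (length w))"
    by (simp only: of_int_le_iff)
  then have "real (?c M) - 1.5 * real M \<ge> 0.5 * of_int (q - int n) - real (length w)"
    by (simp add: field_simps)
  moreover have "n \<le> M" using nJ JM by simp
  ultimately show ?thesis by blast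
qed

end

section \<open>Assembling the bound\<close>

text \<open>
  If both loops avoided \<open>w\<close>, it would not occur at all, since each position lies in a loop; if
  both met \<open>w\<close>, it would occur with bounded gaps.
\<close>

lemma (in single_branching) excursions_or_swapped:
  assumes w: "length w \<le> n" "w \<noteq> []" "window x (length w) t0 = w"
    and gaps: "\<And>N. \<exists>s. \<forall>t. s \<le> t \<and> t \<le> s + N \<longrightarrow> window x (length w) t \<noteq> w"
  shows "excursions x n r a b w \<or> excursions x n r b a w"
proof -
  let ?occ = "\<lambda>t. window x (length w) t = w"
  define free where "free c \<longleftrightarrow> (\<forall>i s. W i = r \<longrightarrow> nxt i = c \<longrightarrow> 0 \<le> s \<longrightarrow> s < ret c \<longrightarrow> \<not> ?occ (i + s))" for c
  have meets: "\<exists>s. 0 \<le> s \<and> s < ret c \<and> ?occ (i + s)" if "\<not> free c" "W i = r" "nxt i = c" for c i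
  proof -
    obtain j s where j: "W j = r" "nxt j = c" "0 \<le> s" "s < ret c" "?occ (j + s)"
      using \<open>\<not> free c\<close> by (auto simp: free_def)
    have "W (i + s) = W (j + s)" using j that by (intro same_loop) auto
    from window_sub[OF this, of 0 "length w"] have "?occ (i + s)" using j w by simp
    then show ?thesis using j by blast
  qed
  have "\<not> (free a \<and> free b)"
  proof
    assume f: "free a \<and> free b"
    obtain i where i: "W i = r" "i \<le> t0" "t0 < i + ret (nxt i)" by (rule in_loop)
    have "free (nxt i)" using f letters i(1) by auto
    from this[unfolded free_def, rule_format, of i "t0 - i"]
    have "\<not> ?occ (i + (t0 - i))" using i by simp
    then show False using w by simp
  qed
  moreover have "free a \<or> free b"
  proof (rule ccontr)
    assume nf: "\<not> ?thesis"
    obtain ia ib where ab: "W ia = r" "nxt ia = a" "W ib = r" "nxt ib = b"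
      using occurs_a occurs_b by blast
    have pos: "0 < ret a" "0 < ret b" using ret_pos ab by metis+
    obtain s where s: "\<And>t. s \<le> t \<Longrightarrow> t \<le> s + 2 * (ret a + ret b) \<Longrightarrow> \<not> ?occ t" using gaps by blast
    obtain i where i: "W i = r" "i \<le> s" "s < i + ret (nxt i)" by (rule in_loop)
    define j where "j = i + ret (nxt i)"
    have j: "W j = r" "s \<le> j" "j \<le> s + ret a + ret b"
      using W_ret[OF i(1)] i letters[OF i(1)] pos by (auto simp: j_def)
    have "\<not> free (nxt j)" using nf letters[OF j(1)] by auto
    then obtain u where "0 \<le> u" "u < ret (nxt j)" "?occ (j + u)" using meets j by blast
    moreover have "ret (nxt j) \<le> ret a + ret b" using letters[OF j(1)] pos by auto
    ultimately show False using s[of "j + u"] j by auto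
  qed
  moreover have "excursions x n r c c' w"
    if "single_branching x n r c c'" "free c" "\<not> free c'" for c c'
  proof -
    interpret sb: single_branching x n r c c' by fact
    show ?thesis
    proof (unfold_locales)
      show "length w \<le> n" "w \<noteq> []" by fact+
      show "\<exists>s. \<forall>t. s \<le> t \<and> t \<le> s + N \<longrightarrow> \<not> ?occ t" for N by (rule gaps)
    next
      fix i s assume "W i = r" "nxt i = c" "0 \<le> s" "s < ret c"
      then show "\<not> ?occ (i + s)" using \<open>free c\<close> by (auto simp: free_def)
    next
      fix i assume "W i = r" "nxt i = c'"
      then show "\<exists>s. 0 \<le> s \<and> s < ret c' \<and> ?occ (i + s)"
        using meets \<open>\<not> free c'\<close> by blast
    qed
  qed
  moreover have "single_branching x n r a b" "single_branching x n r b a"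
    using fin n_pos nep a_neq_b branch letters occurs_a occurs_b
    by (unfold_locales; blast)+
  ultimately show ?thesis by blast
qed

lemma excursions_at_growth_one:
  assumes fin: "finite (range x)" and nep: "\<not> eventually_periodic_both_directions x"
    and growth: "word_complexity (Suc n) x = word_complexity n x + 1"
    and w: "length w \<le> n" "w \<noteq> []" "window x (length w) t0 = w"
    and gaps: "\<And>N. \<exists>s. \<forall>t. s \<le> t \<and> t \<le> s + N \<longrightarrow> window x (length w) t \<noteq> w"
  obtains r a b where "excursions x n r a b w"
proof -
  obtain i0 j0 where ij: "window x n i0 = window x n j0" "x (i0 + int n) \<noteq> x (j0 + int n)"
    "\<And>i j. window x n i = window x n j \<Longrightarrow> x (i + int n) \<noteq> x (j + int n) \<Longrightarrow>
        window x n i = window x n i0"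
    "\<And>i. window x n i = window x n i0 \<Longrightarrow>
        x (i + int n) = x (i0 + int n) \<or> x (i + int n) = x (j0 + int n)"
    by (rule growth_one_unique_branching[OF fin growth]) blast
  have n: "n \<ge> 1" using w by (cases w) auto
  interpret single_branching x n "window x n i0" "x (i0 + int n)" "x (j0 + int n)"
  proof
    show "\<exists>i. window x n i = window x n i0 \<and> x (i + int n) = x (j0 + int n)"
      using ij(1) by metis
  qed (use fin nep n ij in blast)+
  show thesis using excursions_or_swapped[OF w gaps] that by blast
qed

lemma not_uniformly_recurrent_gaps:
  assumes "\<not> uniformly_recurrent x"
  obtains w t0 where "w \<noteq> []" "window x (length w) t0 = w"
    "\<And>N. \<exists>s. \<forall>t. s \<le> t \<and> t \<le> s + N \<longrightarrow> window x (length w) t \<noteq> w"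
proof -
  obtain w where w: "w \<noteq> []" "subword_of w x"
    and none: "\<And>N. N \<ge> 1 \<Longrightarrow> \<exists>v. length v = N \<and> subword_of v x \<and> \<not> sublist w v"
    using assms unfolding uniformly_recurrent_def by blast
  obtain t0 where t0: "window x (length w) t0 = w" using w by (auto simp: subword_of_iff_window)
  have "\<exists>s. \<forall>t. s \<le> t \<and> t \<le> s + N \<longrightarrow> window x (length w) t \<noteq> w" for N
  proof -
    define m where "m = nat N + length w"
    obtain v where v: "length v = m" "subword_of v x" "\<not> sublist w v"
      using none[of m] w by (auto simp: m_def Suc_le_eq)
    obtain s where s: "window x m s = v" using v by (auto simp: subword_of_iff_window)
    have "window x (length w) t \<noteq> w" if t: "s \<le> t" "t \<le> s + N" for t
    proof
      assume occ: "window x (length w) t = w"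
      define k where "k = nat (t - s)"
      have k: "t = s + int k" "k \<le> nat N" using t by (auto simp: k_def)
      have "take (length w) (drop k v) = window x (length w) t"
        unfolding s[symmetric] using k
        by (intro nth_equalityI) (auto simp: window_def m_def algebra_simps)
      then have "sublist w v"
        using occ by (metis sublist_order.order_trans sublist_drop sublist_take)
      then show False using v by simp
    qed
    then show ?thesis by blast
  qed
  then show thesis using that w(1) t0 by blast
qed

lemma limsup_eq_infinity:
  fixes f :: "nat \<Rightarrow> real"
  assumes "\<And>C N. \<exists>M\<ge>N. C \<le> f M"
  shows "limsup (\<lambda>n. ereal (f n)) = \<infinity>"
proof (rule ereal_top)
  fix C :: real
  have "ereal C \<le> (SUP m\<in>{n..}. ereal (f m))" for n
  proof -
    obtain M where "M \<ge> n" "C \<le> f M" using assms by blast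
    then show ?thesis by (intro SUP_upper2[of M]) auto
  qed
  then show "ereal C \<le> limsup (\<lambda>n. ereal (f n))"
    by (auto simp: limsup_INF_SUP intro: INF_greatest)
qed

theorem theorem1p2:
  fixes A :: "'a set" and x :: "int \<Rightarrow> 'a"
  assumes "finite A"
    and "\<forall>i. x i \<in> A"
    and "\<not> uniformly_recurrent x"
    and "\<not> eventually_periodic_both_directions x"
  shows "limsup (\<lambda>n. ereal (real (word_complexity n x) - 1.5 * real n)) = \<infinity>"
proof (rule limsup_eq_infinity)
  fix C :: real and N :: nat
  let ?c = "\<lambda>n. word_complexity n x"
  have fin: "finite (range x)" using assms(1,2) by (auto intro: finite_subset)
  note nep = assms(4)
  obtain w t0 where w: "w \<noteq> []" "window x (length w) t0 = w"
    and gaps: "\<And>N. \<exists>s. \<forall>t. s \<le> t \<and> t \<le> s + N \<longrightarrow> window x (length w) t \<noteq> w"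
    by (rule not_uniformly_recurrent_gaps[OF assms(3)]) blast
  show "\<exists>M\<ge>N. C \<le> real (?c M) - 1.5 * real M"
  proof (cases "\<forall>m. \<exists>n\<ge>m. ?c (Suc n) = ?c n + 1")
    case True
    then have level: "\<exists>n r a b. m \<le> n \<and> excursions x n r a b w" for m
    proof -
      obtain n where n: "n \<ge> max m (length w)" "?c (Suc n) = ?c n + 1" using True by blast
      then show ?thesis
        using excursions_at_growth_one[OF fin nep n(2) _ w gaps] by (metis max.bounded_iff)
    qed
    have free_branching: "\<exists>i j. window x m i = window x m j \<and> x (i + int m) \<noteq> x (j + int m) \<and>
      (\<forall>t. i \<le> t \<and> t + int (length w) \<le> i + int m \<longrightarrow> window x (length w) t \<noteq> w)" for m
    proof -
      obtain n r a b where n: "m \<le> n" and "excursions x n r a b w" using level by blast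
      then interpret excursions x n r a b w by simp
      obtain i j where ij: "window x n i = r" "x (i + int n) = a" "window x n j = r" "x (j + int n) = b"
        using occurs_a occurs_b by blast
      \<comment> \<open>The suffix of length \<open>m\<close> of the right special word \<open>r\<close> of a larger length \<open>n\<close>.\<close>
      let ?s = "int n - int m"
      have "window x m (i + ?s) = window x m (j + ?s)"
        using ij n by (intro window_sub[where n = n]) auto
      moreover have "x (i + ?s + int m) \<noteq> x (j + ?s + int m)" using ij a_neq_b by simp
      moreover have "window x (length w) t \<noteq> w"
        if "i + ?s \<le> t" "t + int (length w) \<le> i + ?s + int m" for t
        using that n by (intro r_free[OF ij(1)]) auto
      ultimately show ?thesis by blast
    qed
    \<comment> \<open>Two occurrences of \<open>w\<close> this far apart force \<open>q - n > T\<close> at every sufficiently large length,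
      and \<open>T\<close> is chosen so that \<open>0.5 T - |w| \<ge> C\<close>.\<close>
    define T where "T = nat \<lceil>2 * (C + real (length w))\<rceil>"
    obtain n0 r0 a0 b0 where "excursions x n0 r0 a0 b0 w" using level by blast
    then obtain t t' where t: "window x (length w) t = w" "window x (length w) t' = w"
      "int T + int (length w) \<le> t' - t"
      using excursions.occ_spread[of x n0 r0 a0 b0 w "int T + int (length w)"] by blast
    obtain n r a b where n: "max N (nat (t' - t + int (length w))) \<le> n"
      and ex: "excursions x n r a b w" using level by blast
    interpret excursions x n r a b w by fact
    have "int n + int T < q" using t n by (intro excursion_long[OF t]) auto
    then have "real_of_int (int n + int T) \<le> real_of_int q" by linarith
    moreover have "2 * (C + real (length w)) \<le> real T" unfolding T_def by linarith
    ultimately have "C \<le> 0.5 * of_int (q - int n) - real (length w)"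
      by (simp add: field_simps)
    moreover obtain M where "M \<ge> n"
      "0.5 * of_int (q - int n) - real (length w) \<le> real (?c M) - 1.5 * real M"
      using complexity_large[OF free_branching] by blast
    ultimately show ?thesis using n by (intro exI[of _ M]) auto
  next
    case False
    then obtain m where m: "\<And>n. n \<ge> m \<Longrightarrow> ?c (Suc n) \<noteq> ?c n + 1" by blast
    define m' where "m' = max m 1"
    have two: "?c n + 2 \<le> ?c (Suc n)" if "n \<ge> m'" for n
      using complexity_strictly_grows[OF fin _ nep, of n] m[of n] that by (auto simp: m'_def)
    have grow: "2 * k \<le> ?c (m' + k)" for k
    proof (induction k)
      case (Suc k) then show ?case using two[of "m' + k"] by simp
    qed simp
    define k where "k = nat \<lceil>2 * C\<rceil> + 3 * m' + N"
    have "2 * C + 3 * real m' \<le> real k" unfolding k_def by linarith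
    moreover have "real (2 * k) \<le> real (?c (m' + k))" using grow by (simp only: of_nat_le_iff)
    ultimately have "C \<le> real (?c (m' + k)) - 1.5 * real (m' + k)"
      by (simp add: field_simps)
    then show ?thesis by (intro exI[of _ "m' + k"]) (auto simp: k_def)
  qed
qed

end
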